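(* Let $r\geq 1$ and let $f_1,\dots,f_r\colon X\to Y$ be fibrewise pointed maps over $B$. Then $$D_B(f_1,\dots,f_r)\le \prod_{i=1}^r\bigl(\mathrm{cat}_B^*(f_i)+1\bigr)-1.$$
   Context: All spaces are topological spaces, all maps are continuous, $I=[0,1]$. A fibrewise space over $B$ is a space $X$ with a map $p_X\colon X\to B$; a fibrewise map $f\colon X\to Y$ satisfies $p_Y\circ f=p_X$. Subspaces are fibrewise by restriction. $f\simeq_B g$ means there is $H\colon X\times I\to Y$ with $p_Y(H(x,t))=p_X(x)$, $H(\cdot,0)=f$, $H(\cdot,1)=g$. A fibrewise pointed space over $B$ is a fibrewise space $X$ with a section $s_X\colon B\to X$ of $p_X$; a fibrewise pointed map $f\colon X\to Y$ is a fibrewise map with $f\circ s_X=s_Y$. $D_B(f_1,\dots,f_r)$ is the least $n\ge 0$ (or $\infty$) such that $X$ has an open cover $\{U_0,\dots,U_n\}$ with $f_s|_{U_i}\simeq_B f_t|_{U_i}$ for all $0\le i\le n$, $1\le s,t\le r$. For a fibrewise pointed map $f\colon X\to Y$, $\mathrm{cat}_B^*(f)$ is the least $k\ge 0$ (or $\infty$) such that $X$ has an open cover $\{U_0,\dots,U_k\}$ with $f|_{U_i}\simeq_B s_Y\circ p_X|_{U_i}$ for each $i$. *)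

theory Defs
  imports "HOL-Analysis.Analysis" "HOL-Library.Extended_Nat"
begin

definition fibrewise_space :: "'b topology \<Rightarrow> 'x topology \<Rightarrow> ('x \<Rightarrow> 'b) \<Rightarrow> bool" where
  "fibrewise_space B X p \<longleftrightarrow> continuous_map X B p"

definition fibrewise_map ::
  "'x topology \<Rightarrow> ('x \<Rightarrow> 'b) \<Rightarrow> 'y topology \<Rightarrow> ('y \<Rightarrow> 'b) \<Rightarrow> ('x \<Rightarrow> 'y) \<Rightarrow> bool" where
  "fibrewise_map X p Y q f \<longleftrightarrow> continuous_map X Y f \<and> (\<forall>x\<in>topspace X. q (f x) = p x)"

definition fibrewise_pointed_space ::
  "'b topology \<Rightarrow> 'x topology \<Rightarrow> ('x \<Rightarrow> 'b) \<Rightarrow> ('b \<Rightarrow> 'x) \<Rightarrow> bool" where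
  "fibrewise_pointed_space B X p s \<longleftrightarrow>
     fibrewise_space B X p \<and> continuous_map B X s \<and> (\<forall>b\<in>topspace B. p (s b) = b)"

definition fibrewise_pointed_map ::
  "'b topology \<Rightarrow> 'x topology \<Rightarrow> ('x \<Rightarrow> 'b) \<Rightarrow> ('b \<Rightarrow> 'x) \<Rightarrow>
   'y topology \<Rightarrow> ('y \<Rightarrow> 'b) \<Rightarrow> ('b \<Rightarrow> 'y) \<Rightarrow> ('x \<Rightarrow> 'y) \<Rightarrow> bool" where
  "fibrewise_pointed_map B X p s Y q t f \<longleftrightarrow>
     fibrewise_map X p Y q f \<and> (\<forall>b\<in>topspace B. f (s b) = t b)"

text \<open>A homotopy through fibrewise maps; continuity of each stage is part of
  \<^const>\<open>homotopic_with\<close>. The base space enters only through the projections.\<close>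

definition fibrewise_homotopic ::
  "'x topology \<Rightarrow> ('x \<Rightarrow> 'b) \<Rightarrow> 'y topology \<Rightarrow> ('y \<Rightarrow> 'b) \<Rightarrow> ('x \<Rightarrow> 'y) \<Rightarrow> ('x \<Rightarrow> 'y) \<Rightarrow> bool" where
  "fibrewise_homotopic X p Y q f g \<longleftrightarrow>
     homotopic_with (\<lambda>h. \<forall>x\<in>topspace X. q (h x) = p x) X Y f g"

text \<open>\<^const>\<open>homotopic_with\<close> puts the time parameter first and prescribes the end maps even
  outside the carrier of the source; neither makes a difference:\<close>

lemma fibrewise_homotopic_iff:
  "fibrewise_homotopic X p Y q f g \<longleftrightarrow>
     (\<exists>H. continuous_map (prod_topology X (top_of_set {0..1::real})) Y H \<and>
          (\<forall>x\<in>topspace X. \<forall>t\<in>{0..1}. q (H (x, t)) = p x) \<and>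
          (\<forall>x\<in>topspace X. H (x, 0) = f x) \<and> (\<forall>x\<in>topspace X. H (x, 1) = g x))"
  (is "?L \<longleftrightarrow> ?R")
proof -
  let ?I = "top_of_set {0..1::real}"
  have "?L \<longleftrightarrow> (\<exists>h. continuous_map (prod_topology ?I X) Y h \<and>
          (\<forall>x\<in>topspace X. h (0, x) = f x) \<and> (\<forall>x\<in>topspace X. h (1, x) = g x) \<and>
          (\<forall>t\<in>{0..1}. \<forall>x\<in>topspace X. q (h (t, x)) = p x))"
    unfolding fibrewise_homotopic_def by (subst homotopic_with) auto
  also have "\<dots> \<longleftrightarrow> ?R"
  proof
    assume "\<exists>h. continuous_map (prod_topology ?I X) Y h \<and>
          (\<forall>x\<in>topspace X. h (0, x) = f x) \<and> (\<forall>x\<in>topspace X. h (1, x) = g x) \<and>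
          (\<forall>t\<in>{0..1}. \<forall>x\<in>topspace X. q (h (t, x)) = p x)"
    then obtain h where h: "continuous_map (prod_topology ?I X) Y h"
      "\<forall>x\<in>topspace X. h (0, x) = f x" "\<forall>x\<in>topspace X. h (1, x) = g x"
      "\<forall>t\<in>{0..1}. \<forall>x\<in>topspace X. q (h (t, x)) = p x" by blast
    have "continuous_map (prod_topology X ?I) Y (h \<circ> (\<lambda>(x, t). (t, x)))"
      by (rule continuous_map_compose[OF _ h(1)]) (auto simp: case_prod_beta' intro!: continuous_intros)
    with h show ?R by (intro exI[of _ "h \<circ> (\<lambda>(x, t). (t, x))"]) auto
  next
    assume ?R
    then obtain H where H: "continuous_map (prod_topology X ?I) Y H"
      "\<forall>x\<in>topspace X. \<forall>t\<in>{0..1}. q (H (x, t)) = p x"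
      "\<forall>x\<in>topspace X. H (x, 0) = f x" "\<forall>x\<in>topspace X. H (x, 1) = g x" by blast
    have "continuous_map (prod_topology ?I X) Y (H \<circ> (\<lambda>(t, x). (x, t)))"
      by (rule continuous_map_compose[OF _ H(1)]) (auto simp: case_prod_beta' intro!: continuous_intros)
    with H show "\<exists>h. continuous_map (prod_topology ?I X) Y h \<and>
          (\<forall>x\<in>topspace X. h (0, x) = f x) \<and> (\<forall>x\<in>topspace X. h (1, x) = g x) \<and>
          (\<forall>t\<in>{0..1}. \<forall>x\<in>topspace X. q (h (t, x)) = p x)"
      by (intro exI[of _ "H \<circ> (\<lambda>(t, x). (x, t))"]) auto
  qed
  finally show ?thesis .
qed

definition open_cover_upto :: "'x topology \<Rightarrow> nat \<Rightarrow> (nat \<Rightarrow> 'x set) \<Rightarrow> bool" where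
  "open_cover_upto X n U \<longleftrightarrow> (\<forall>i\<le>n. openin X (U i)) \<and> (\<Union>i\<le>n. U i) = topspace X"

text \<open>The maps are \<open>f 1, \<dots>, f r\<close>. The infimum of the empty set in \<^typ>\<open>enat\<close> is \<open>\<infinity>\<close>.\<close>

definition fibrewise_homotopic_distance ::
  "'x topology \<Rightarrow> ('x \<Rightarrow> 'b) \<Rightarrow> 'y topology \<Rightarrow> ('y \<Rightarrow> 'b) \<Rightarrow> nat \<Rightarrow> (nat \<Rightarrow> 'x \<Rightarrow> 'y) \<Rightarrow> enat" where
  "fibrewise_homotopic_distance X p Y q r f =
     Inf {enat n | n. \<exists>U. open_cover_upto X n U \<and>
       (\<forall>i\<le>n. \<forall>s\<in>{1..r}. \<forall>t\<in>{1..r}.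
          fibrewise_homotopic (subtopology X (U i)) p Y q (f s) (f t))}"

text \<open>Here \<open>t\<close> is the section of \<open>Y\<close>. The homotopies are fibrewise but need not be pointed.\<close>

definition fibrewise_cat ::
  "'x topology \<Rightarrow> ('x \<Rightarrow> 'b) \<Rightarrow> 'y topology \<Rightarrow> ('y \<Rightarrow> 'b) \<Rightarrow> ('b \<Rightarrow> 'y) \<Rightarrow> ('x \<Rightarrow> 'y) \<Rightarrow> enat" where
  "fibrewise_cat X p Y q t f =
     Inf {enat k | k. \<exists>U. open_cover_upto X k U \<and>
       (\<forall>i\<le>k. fibrewise_homotopic (subtopology X (U i)) p Y q f (t \<circ> p))}"

end

theory Submission
  imports Defs
begin

text \<open>
  Suppose that each \<open>f i\<close> is fibrewise null-homotopic on every member of an open cover of \<open>X\<close>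
  with \<open>k i + 1\<close> members. On an intersection of one member from each of these \<open>r\<close> covers all
  the maps \<open>f i\<close> are fibrewise homotopic to the single map \<open>s\<^sub>Y \<circ> p\<^sub>X\<close>, hence to one another.
  The intersections are indexed by choice functions, of which there are \<open>\<Prod>i. (k i + 1)\<close>; this
  common refinement of the covers (\<open>open_cover_common_refinement\<close>) bounds the homotopic
  distance (\<open>fibrewise_homotopic_distance_le_card\<close>). If some \<open>f i\<close> has infinite category,
  the right-hand side is \<open>\<infinity>\<close>, because every factor is at least 1.
\<close>

lemma fibrewise_homotopic_sym:
  "fibrewise_homotopic X p Y q f g \<Longrightarrow> fibrewise_homotopic X p Y q g f"
  unfolding fibrewise_homotopic_def by (simp add: homotopic_with_sym)

lemma fibrewise_homotopic_trans:
  "fibrewise_homotopic X p Y q f g \<Longrightarrow> fibrewise_homotopic X p Y q g h \<Longrightarrow>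
     fibrewise_homotopic X p Y q f h"
  unfolding fibrewise_homotopic_def by (rule homotopic_with_trans)

lemma fibrewise_homotopic_subset:
  assumes "fibrewise_homotopic (subtopology X U) p Y q f g" and "V \<subseteq> U"
  shows "fibrewise_homotopic (subtopology X V) p Y q f g"
proof -
  have "continuous_map (subtopology X V) (subtopology X U) id"
    using assms(2) by (auto simp: continuous_map_in_subtopology)
  from homotopic_with_compose_continuous_map_right
    [OF assms(1)[unfolded fibrewise_homotopic_def] this,
      of "\<lambda>h. \<forall>x\<in>topspace (subtopology X V). q (h x) = p x"]
  show ?thesis
    using assms(2) unfolding fibrewise_homotopic_def by (auto simp: subset_iff)
qed

text \<open>The infimum of a nonempty set of extended natural numbers is attained, so a finite
  category is realised by a cover.\<close>

lemma fibrewise_cat_eq_enat_imp_cover: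
  assumes "fibrewise_cat X p Y q t f = enat k"
  obtains U where "open_cover_upto X k U"
    and "\<And>i. i \<le> k \<Longrightarrow> fibrewise_homotopic (subtopology X (U i)) p Y q f (t \<circ> p)"
proof -
  let ?S = "{enat k | k. \<exists>U. open_cover_upto X k U \<and>
       (\<forall>i\<le>k. fibrewise_homotopic (subtopology X (U i)) p Y q f (t \<circ> p))}"
  have Inf: "Inf ?S = enat k"
    using assms unfolding fibrewise_cat_def .
  then have "?S \<noteq> {}"
    by (metis Inf_enat_def enat.distinct(1))
  then have "Inf ?S \<in> ?S"
    unfolding Inf_enat_def by (metis (no_types, lifting) LeastI ex_in_conv)
  then have "enat k \<in> ?S"
    by (simp only: Inf)
  then show thesis
    using that by auto
qed

lemma fibrewise_homotopic_distance_le_card: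
  assumes J: "finite J" "J \<noteq> {}"
    and V: "\<And>j. j \<in> J \<Longrightarrow> openin X (V j)" "(\<Union>j\<in>J. V j) = topspace X"
    and hom: "\<And>j s t. \<lbrakk>j \<in> J; s \<in> {1..r}; t \<in> {1..r}\<rbrakk> \<Longrightarrow>
      fibrewise_homotopic (subtopology X (V j)) p Y q (f s) (f t)"
  shows "fibrewise_homotopic_distance X p Y q r f \<le> enat (card J - 1)"
proof -
  obtain e where e: "bij_betw e {0..<card J} J"
    using ex_bij_betw_nat_finite[OF J(1)] by blast
  have "card J > 0"
    using J by (simp add: card_gt_0_iff)
  then have "{..card J - 1} = {0..<card J}"
    by auto
  with e have img: "e ` {..card J - 1} = J"
    by (simp add: bij_betw_def)
  have "open_cover_upto X (card J - 1) (V \<circ> e)"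
    unfolding open_cover_upto_def
  proof (intro conjI allI impI)
    show "openin X ((V \<circ> e) i)" if "i \<le> card J - 1" for i
      using that img V(1) by auto
    have "(\<Union>i\<le>card J - 1. (V \<circ> e) i) = \<Union> (V ` (e ` {..card J - 1}))"
      by (simp add: image_comp)
    then show "(\<Union>i\<le>card J - 1. (V \<circ> e) i) = topspace X"
      by (simp only: img V(2))
  qed
  moreover have "fibrewise_homotopic (subtopology X ((V \<circ> e) i)) p Y q (f s) (f t)"
    if "i \<le> card J - 1" "s \<in> {1..r}" "t \<in> {1..r}" for i s t
    using that img hom[of "e i" s t] by auto
  ultimately show ?thesis
    unfolding fibrewise_homotopic_distance_def by (intro Inf_lower) blast
qed

text \<open>A point of \<open>X\<close> lies in some member of each cover, and picking one member for every \<open>i\<close>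
  gives the choice function whose intersection contains the point. The index set \<open>I\<close> is nonempty
  because an empty intersection would be the whole type, not the space.\<close>

lemma open_cover_common_refinement:
  assumes I: "finite I" "I \<noteq> {}"
    and U: "\<And>i. i \<in> I \<Longrightarrow> open_cover_upto X (k i) (U i)"
  defines "J \<equiv> PiE I (\<lambda>i. {..k i})"
  shows "\<And>c. c \<in> J \<Longrightarrow> openin X (\<Inter>i\<in>I. U i (c i))"
    and "(\<Union>c\<in>J. \<Inter>i\<in>I. U i (c i)) = topspace X"
proof -
  show op: "openin X (\<Inter>i\<in>I. U i (c i))" if "c \<in> J" for c
    using that U by (intro openin_INT2 I) (auto simp: J_def open_cover_upto_def PiE_iff)
  show "(\<Union>c\<in>J. \<Inter>i\<in>I. U i (c i)) = topspace X"
  proof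
    show "(\<Union>c\<in>J. \<Inter>i\<in>I. U i (c i)) \<subseteq> topspace X"
      using op openin_subset by blast
    show "topspace X \<subseteq> (\<Union>c\<in>J. \<Inter>i\<in>I. U i (c i))"
    proof
      fix x assume "x \<in> topspace X"
      then have "\<forall>i\<in>I. \<exists>j\<le>k i. x \<in> U i j"
        using U unfolding open_cover_upto_def by blast
      then obtain c where "\<forall>i\<in>I. c i \<le> k i \<and> x \<in> U i (c i)"
        by metis
      then have "restrict c I \<in> J" "x \<in> (\<Inter>i\<in>I. U i (restrict c I i))"
        by (auto simp: J_def)
      then show "x \<in> (\<Union>c\<in>J. \<Inter>i\<in>I. U i (c i))"
        by blast
    qed
  qed
qed

lemma prod_enat_eq_infinity:
  fixes g :: "'a \<Rightarrow> enat"
  assumes "finite A" "a \<in> A" "g a = \<infinity>" "\<And>x. x \<in> A \<Longrightarrow> g x \<noteq> 0"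
  shows "prod g A = \<infinity>"
proof -
  have "prod g S \<noteq> 0" if "S \<subseteq> A" for S
    using finite_subset[OF that assms(1)] that
    by (induction S rule: finite_induct) (simp_all add: assms(4) imult_is_0)
  then have "prod g (A - {a}) \<noteq> 0"
    by blast
  then show ?thesis
    using prod.remove[OF assms(1,2), of g] assms(3) by (simp add: imult_is_infinity)
qed

lemma prod_enat: "prod (\<lambda>i. enat (g i)) A = enat (prod g A)"
  by (induction A rule: infinite_finite_induct) (simp_all add: one_enat_def)

theorem proposition5p3:
  fixes B :: "'b topology" and X :: "'x topology" and Y :: "'y topology"
    and p\<^sub>X :: "'x \<Rightarrow> 'b" and s\<^sub>X :: "'b \<Rightarrow> 'x"
    and p\<^sub>Y :: "'y \<Rightarrow> 'b" and s\<^sub>Y :: "'b \<Rightarrow> 'y"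
    and r :: nat and f :: "nat \<Rightarrow> 'x \<Rightarrow> 'y"
  assumes "fibrewise_pointed_space B X p\<^sub>X s\<^sub>X"
    and "fibrewise_pointed_space B Y p\<^sub>Y s\<^sub>Y"
    and "r \<ge> 1"
    and "\<And>i. i \<in> {1..r} \<Longrightarrow> fibrewise_pointed_map B X p\<^sub>X s\<^sub>X Y p\<^sub>Y s\<^sub>Y (f i)"
  shows "fibrewise_homotopic_distance X p\<^sub>X Y p\<^sub>Y r f
           \<le> (\<Prod>i=1..r. fibrewise_cat X p\<^sub>X Y p\<^sub>Y s\<^sub>Y (f i) + 1) - 1"
proof (cases "\<exists>i\<in>{1..r}. fibrewise_cat X p\<^sub>X Y p\<^sub>Y s\<^sub>Y (f i) = \<infinity>")
  case True
  then obtain i where i: "i \<in> {1..r}" "fibrewise_cat X p\<^sub>X Y p\<^sub>Y s\<^sub>Y (f i) = \<infinity>"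
    by blast
  have "(\<Prod>i=1..r. fibrewise_cat X p\<^sub>X Y p\<^sub>Y s\<^sub>Y (f i) + 1) = \<infinity>"
    by (rule prod_enat_eq_infinity[OF _ i(1)]) (simp_all add: i(2))
  then show ?thesis
    by (simp add: one_enat_def)
next
  case False
  then have "\<forall>i\<in>{1..r}. \<exists>k. fibrewise_cat X p\<^sub>X Y p\<^sub>Y s\<^sub>Y (f i) = enat k"
    by auto
  then obtain k where k: "\<And>i. i \<in> {1..r} \<Longrightarrow> fibrewise_cat X p\<^sub>X Y p\<^sub>Y s\<^sub>Y (f i) = enat (k i)"
    by metis
  have "\<forall>i\<in>{1..r}. \<exists>U. open_cover_upto X (k i) U \<and>
      (\<forall>j\<le>k i. fibrewise_homotopic (subtopology X (U j)) p\<^sub>X Y p\<^sub>Y (f i) (s\<^sub>Y \<circ> p\<^sub>X))"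
    using k by (metis fibrewise_cat_eq_enat_imp_cover)
  then obtain U where U: "\<And>i. i \<in> {1..r} \<Longrightarrow> open_cover_upto X (k i) (U i)"
    and null: "\<And>i j. \<lbrakk>i \<in> {1..r}; j \<le> k i\<rbrakk> \<Longrightarrow>
      fibrewise_homotopic (subtopology X (U i j)) p\<^sub>X Y p\<^sub>Y (f i) (s\<^sub>Y \<circ> p\<^sub>X)"
    by metis
  define J where "J = PiE {1..r} (\<lambda>i. {..k i})"
  define V where "V c = (\<Inter>i\<in>{1..r}. U i (c i))" for c
  have ne: "{1..r} \<noteq> {}"
    using assms(3) by simp
  have null_V: "fibrewise_homotopic (subtopology X (V c)) p\<^sub>X Y p\<^sub>Y (f i) (s\<^sub>Y \<circ> p\<^sub>X)"
    if "c \<in> J" "i \<in> {1..r}" for c i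
  proof (rule fibrewise_homotopic_subset)
    show "fibrewise_homotopic (subtopology X (U i (c i))) p\<^sub>X Y p\<^sub>Y (f i) (s\<^sub>Y \<circ> p\<^sub>X)"
      using that by (intro null) (auto simp: J_def)
    show "V c \<subseteq> U i (c i)"
      using that(2) by (auto simp: V_def)
  qed
  have "fibrewise_homotopic_distance X p\<^sub>X Y p\<^sub>Y r f \<le> enat (card J - 1)"
  proof (rule fibrewise_homotopic_distance_le_card)
    show "finite J"
      by (simp add: J_def finite_PiE)
    show "J \<noteq> {}"
      by (simp add: J_def PiE_eq_empty_iff)
    show "openin X (V c)" if "c \<in> J" for c
      using open_cover_common_refinement(1)[OF _ ne U] that by (simp add: J_def V_def)
    show "(\<Union>c\<in>J. V c) = topspace X"
      using open_cover_common_refinement(2)[OF _ ne U] by (simp add: J_def V_def)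
    show "fibrewise_homotopic (subtopology X (V c)) p\<^sub>X Y p\<^sub>Y (f s) (f t)"
      if "c \<in> J" "s \<in> {1..r}" "t \<in> {1..r}" for c s t
      using fibrewise_homotopic_trans[OF null_V fibrewise_homotopic_sym[OF null_V]] that by blast
  qed
  also have "card J = (\<Prod>i=1..r. k i + 1)"
    by (simp add: J_def card_PiE)
  also have "enat ((\<Prod>i=1..r. k i + 1) - 1) = (\<Prod>i=1..r. enat (k i + 1)) - 1"
    by (simp only: prod_enat one_enat_def idiff_enat_enat)
  also have "(\<Prod>i=1..r. enat (k i + 1)) = (\<Prod>i=1..r. fibrewise_cat X p\<^sub>X Y p\<^sub>Y s\<^sub>Y (f i) + 1)"
    by (intro prod.cong) (simp_all add: k one_enat_def)
  finally show ?thesis .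
qed

end
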